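(* For every $p\in\mathcal A_+$, $$\langle0|\,p=\langle0|\,\varphi(p),$$ where $\varphi(p)\in\mathbb Z[t,t^{-1}][\widehat Q_1]$ is the polynomial obtained from $p=\sum_{j\in\mathbb Z}\widehat Q_1^jf_j(\widehat Q_0)$ by $\varphi(p)=\sum_{j\ge0}f_j(t^{-j-1})\widehat Q_1^j$.
   Context: $t$ is an indeterminate, $\mathbb Z_+=\{0,1,2,\dots\}$. Let $\widehat Q_0,\widehat Q_1$ be invertible with $\widehat Q_0\widehat Q_1=t\,\widehat Q_1\widehat Q_0$, and define $\widehat Q_j$ ($j\in\mathbb Z$) by the $A_1$ quantum $Q$-system $t\,\widehat Q_{j+1}\widehat Q_{j-1}=\widehat Q_j^2-1$; then $\widehat Q_j\widehat Q_{j+1}=t\,\widehat Q_{j+1}\widehat Q_j$ and all $\widehat Q_j$ lie in the quantum torus $\mathbb Z[t^{\pm1}]\langle\widehat Q_0^{\pm1},\widehat Q_1^{\pm1}\rangle$. Let $\mathcal A_+$ be the $\mathbb Z[t^{\pm1}]$-algebra generated by $\widehat Q_0,\widehat Q_0^{-1},\widehat Q_m$ ($m\ge1$), viewed inside this quantum torus; so every $p\in\mathcal A_+$ is uniquely a finite sum $\sum_{j\in\mathbb Z}\widehat Q_1^jf_j(\widehat Q_0)$ with $f_j\in\mathbb Z[t^{\pm1}][\widehat Q_0^{\pm1}]$. Consider the cyclic representation of $\mathcal A_+$ (acting from the right) with cyclic vector $\langle0|$ and $\mathbb Z[t^{\pm1}]$-basis $\langle m|$, $m\in\mathbb Z_+$,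 such that $\langle0|\widehat Q_0=t^{-1}\langle0|$ and $\langle m|=t^{m+1}\langle0|\widehat Q_m$ for $m>0$. *)

theory Defs
  imports Complex_Main "HOL-Library.Poly_Mapping"
begin

section \<open>The quantum torus\<close>

text \<open>
  Poly-mappings with exponents in \<^typ>\<open>int\<close> carry the convolution product, so they are
  rings of Laurent polynomials: \<open>zt\<close> is $\mathbb Z[t^{\pm1}]$ and \<open>lpoly\<close> is
  $\mathbb Z[t^{\pm1}][x^{\pm1}]$.
\<close>

type_synonym zt = "int \<Rightarrow>\<^sub>0 int"
type_synonym lpoly = "int \<Rightarrow>\<^sub>0 zt"

definition tpow :: "int \<Rightarrow> zt" where
  "tpow n = Poly_Mapping.single n 1"

text \<open>\<open>dilate c f\<close> is $f(t^c x)$.\<close>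

definition dilate :: "int \<Rightarrow> lpoly \<Rightarrow> lpoly" where
  "dilate c f = Poly_Mapping.mapp (\<lambda>b u. tpow (c * b) * u) f"

text \<open>\<open>eval_tpow k f\<close> is the value $f(t^k)$.\<close>

definition eval_tpow :: "int \<Rightarrow> lpoly \<Rightarrow> zt" where
  "eval_tpow k f = (\<Sum>b\<in>Poly_Mapping.keys f. Poly_Mapping.lookup f b * tpow (k * b))"

text \<open>
  The quantum torus is the skew Laurent polynomial ring in $\widehat Q_1$ over
  $\mathbb Z[t^{\pm1}][\widehat Q_0^{\pm1}]$: the element \<open>Qtorus F\<close> stands for
  $\sum_j \widehat Q_1^j f_j(\widehat Q_0)$ with $f_j$ = \<open>lookup F j\<close>
  (see \<open>qtorus_expansion\<close> below).  Since $\widehat Q_0\widehat Q_1=t\widehat Q_1\widehat Q_0$, one has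
  $\widehat Q_1^a f(\widehat Q_0)\,\widehat Q_1^c g(\widehat Q_0) =
   \widehat Q_1^{a+c} f(t^c\widehat Q_0)\,g(\widehat Q_0)$.
\<close>

datatype qtorus = Qtorus (coeffs: "int \<Rightarrow>\<^sub>0 lpoly")

instantiation qtorus :: "{zero, one, plus, minus, uminus, times}"
begin

definition "0 = Qtorus 0"
definition "1 = Qtorus 1"
definition "p + q = Qtorus (coeffs p + coeffs q)"
definition "p - q = Qtorus (coeffs p - coeffs q)"
definition "- p = Qtorus (- coeffs p)"
definition "p * q = Qtorus (\<Sum>a\<in>Poly_Mapping.keys (coeffs p). \<Sum>c\<in>Poly_Mapping.keys (coeffs q).
   Poly_Mapping.single (a + c)
     (dilate c (Poly_Mapping.lookup (coeffs p) a) * Poly_Mapping.lookup (coeffs q) c))"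

instance ..

end

lemma tpow_0 [simp]: "tpow 0 = 1"
  by (simp add: tpow_def)

lemma tpow_mult: "tpow m * tpow n = tpow (m + n)"
  by (simp add: tpow_def mult_single)

lemma tpow_eq_iff: "tpow m = tpow n \<longleftrightarrow> m = n"
  by (metis lookup_single_eq lookup_single_not_eq tpow_def zero_neq_one)

lemma tpow_neq_0 [simp]: "tpow n \<noteq> 0"
  by (metis lookup_single_eq lookup_zero tpow_def zero_neq_one)

lemma lookup_dilate: "Poly_Mapping.lookup (dilate c f) b = tpow (c * b) * Poly_Mapping.lookup f b"
  by (simp add: dilate_def lookup_mapp when_def in_keys_iff)

lemma dilate_zero [simp]: "dilate c 0 = 0"
  by (rule poly_mapping_eqI) (simp add: lookup_dilate)

lemma dilate_eq_0_iff [simp]: "dilate c f = 0 \<longleftrightarrow> f = 0"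
proof
  assume "dilate c f = 0"
  then have "tpow (c * b) * Poly_Mapping.lookup f b = 0" for b
    by (metis lookup_dilate lookup_zero)
  then show "f = 0" by (intro poly_mapping_eqI) simp
qed simp

lemma dilate_add: "dilate c (f + g) = dilate c f + dilate c g"
  by (rule poly_mapping_eqI) (simp add: lookup_dilate lookup_add algebra_simps)

lemma dilate_dilate: "dilate c (dilate d f) = dilate (c + d) f"
  by (rule poly_mapping_eqI)
    (simp add: lookup_dilate mult.assoc[symmetric] tpow_mult distrib_right)

lemma dilate_by_0 [simp]: "dilate 0 f = f"
  by (rule poly_mapping_eqI) (simp add: lookup_dilate)

lemma dilate_single: "dilate c (Poly_Mapping.single b u) = Poly_Mapping.single b (tpow (c * b) * u)"
  by (rule poly_mapping_eqI) (auto simp: lookup_dilate lookup_single when_def)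

lemma poly_mapping_single_induct [case_names zero single add]:
  fixes f :: "'a \<Rightarrow>\<^sub>0 'b::ab_group_add"
  assumes zero: "P 0" and single: "\<And>a b. P (Poly_Mapping.single a b)"
    and add: "\<And>f g. P f \<Longrightarrow> P g \<Longrightarrow> P (f + g)"
  shows "P f"
proof (induction f rule: update_induct)
  case const
  show ?case by (rule zero)
next
  case (update f a b)
  have "Poly_Mapping.update a b f = Poly_Mapping.single a b + f"
    using update by (intro poly_mapping_eqI)
      (auto simp: lookup_update lookup_add lookup_single when_def in_keys_iff)
  with update show ?case by (auto intro: single add)
qed

lemma dilate_mult: "dilate c (f * g) = dilate c f * dilate c g"
proof (induction f rule: poly_mapping_single_induct)
  case (single a u)
  show ?case
  proof (induction g rule: poly_mapping_single_induct)
    case (single b v)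
    have "tpow (c * (a + b)) = tpow (c * a) * tpow (c * b)"
      by (simp add: tpow_mult algebra_simps)
    then show ?case by (simp add: mult_single dilate_single algebra_simps)
  qed (simp_all add: algebra_simps dilate_add)
qed (simp_all add: algebra_simps dilate_add)

lemma dilate_1 [simp]: "dilate c 1 = 1"
  using dilate_single[of c 0 1] by simp

lemma sum_keys_superset:
  fixes p :: "'a \<Rightarrow>\<^sub>0 'b::zero"
  assumes "finite A" "Poly_Mapping.keys p \<subseteq> A" "\<And>k. g k 0 = 0"
  shows "(\<Sum>k\<in>Poly_Mapping.keys p. g k (Poly_Mapping.lookup p k))
       = (\<Sum>k\<in>A. g k (Poly_Mapping.lookup p k))"
  using assms by (intro sum.mono_neutral_left) (auto simp: in_keys_iff)

lemma sum_keys_add: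
  fixes p q :: "'a \<Rightarrow>\<^sub>0 'b::comm_monoid_add"
  assumes "\<And>k. g k 0 = 0" "\<And>k x y. g k (x + y) = g k x + g k y"
  shows "(\<Sum>k\<in>Poly_Mapping.keys (p + q). g k (Poly_Mapping.lookup (p + q) k))
       = (\<Sum>k\<in>Poly_Mapping.keys p. g k (Poly_Mapping.lookup p k))
       + (\<Sum>k\<in>Poly_Mapping.keys q. g k (Poly_Mapping.lookup q k))"
proof -
  let ?A = "Poly_Mapping.keys p \<union> Poly_Mapping.keys q"
  have "finite ?A" "Poly_Mapping.keys (p + q) \<subseteq> ?A" by (auto dest: set_mp[OF keys_add])
  then show ?thesis
    using sum_keys_superset[of ?A "p + q" g] sum_keys_superset[of ?A p g]
      sum_keys_superset[of ?A q g]
    by (simp add: assms lookup_add sum.distrib)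
qed

lemma qtorus_eq_iff: "p = q \<longleftrightarrow> coeffs p = coeffs q" for p q :: qtorus
  by (metis qtorus.collapse)

lemma coeffs_simps [simp]:
  "coeffs 0 = 0" "coeffs 1 = 1" "coeffs (p + q) = coeffs p + coeffs q"
  "coeffs (p - q) = coeffs p - coeffs q" "coeffs (- p) = - coeffs p"
  by (simp_all add: zero_qtorus_def one_qtorus_def plus_qtorus_def minus_qtorus_def uminus_qtorus_def)

definition qprod :: "(int \<Rightarrow>\<^sub>0 lpoly) \<Rightarrow> (int \<Rightarrow>\<^sub>0 lpoly) \<Rightarrow> (int \<Rightarrow>\<^sub>0 lpoly)" where
  "qprod F G = (\<Sum>a\<in>Poly_Mapping.keys F. \<Sum>c\<in>Poly_Mapping.keys G.
     Poly_Mapping.single (a + c) (dilate c (Poly_Mapping.lookup F a) * Poly_Mapping.lookup G c))"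

lemma coeffs_mult: "coeffs (p * q) = qprod (coeffs p) (coeffs q)"
  by (simp add: times_qtorus_def qprod_def)

lemma qprod_0 [simp]: "qprod 0 G = 0" "qprod F 0 = 0"
  by (simp_all add: qprod_def)

lemma qprod_add_left: "qprod (F + F') G = qprod F G + qprod F' G"
  unfolding qprod_def
  by (rule sum_keys_add[where g = "\<lambda>a f. \<Sum>c\<in>Poly_Mapping.keys G.
     Poly_Mapping.single (a + c) (dilate c f * Poly_Mapping.lookup G c)"])
    (simp_all add: dilate_add distrib_right single_add sum.distrib)

lemma qprod_add_right: "qprod F (G + G') = qprod F G + qprod F G'"
  unfolding qprod_def sum.distrib[symmetric]
  by (intro sum.cong refl sum_keys_add[where g = "\<lambda>c g.
     Poly_Mapping.single (_ + c) (dilate c (Poly_Mapping.lookup F _) * g)"])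
    (simp_all add: distrib_left single_add)

lemma qprod_single:
  "qprod (Poly_Mapping.single a f) (Poly_Mapping.single c g)
   = Poly_Mapping.single (a + c) (dilate c f * g)"
  by (cases "f = 0"; cases "g = 0") (simp_all add: qprod_def)

lemma qprod_assoc: "qprod (qprod F G) H = qprod F (qprod G H)"
proof (induction F rule: poly_mapping_single_induct)
  case (single a f)
  show ?case
  proof (induction G rule: poly_mapping_single_induct)
    case (single b g)
    show ?case
      by (induction H rule: poly_mapping_single_induct)
        (simp_all add: qprod_single qprod_add_right dilate_mult dilate_dilate algebra_simps)
  qed (simp_all add: qprod_add_left qprod_add_right)
qed (simp_all add: qprod_add_left)

lemma qprod_1: "qprod (Poly_Mapping.single 0 1) F = F" "qprod F (Poly_Mapping.single 0 1) = F"
  by (induction F rule: poly_mapping_single_induct)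
    (simp_all del: single_one add: qprod_single qprod_add_left qprod_add_right)

lemma qtorus_one_mult: "1 * p = p" "p * 1 = p" for p :: qtorus
  using qprod_1[of "coeffs p"] by (simp_all add: qtorus_eq_iff coeffs_mult)

instance qtorus :: ring_1
  by standard
    (simp_all add: qtorus_one_mult,
     simp_all add: qtorus_eq_iff coeffs_mult qprod_assoc qprod_add_left qprod_add_right)

text \<open>\<open>inQ0 f\<close> is $f(\widehat Q_0)$, and \<open>Q1pow j\<close> is $\widehat Q_1^j$ for \<open>j \<in> \<int>\<close>.\<close>

definition inQ0 :: "lpoly \<Rightarrow> qtorus" where
  "inQ0 f = Qtorus (Poly_Mapping.single 0 f)"

definition Q1pow :: "int \<Rightarrow> qtorus" where
  "Q1pow j = Qtorus (Poly_Mapping.single j 1)"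

definition const :: "zt \<Rightarrow> qtorus" where
  "const u = inQ0 (Poly_Mapping.single 0 u)"

definition Q0 :: qtorus where
  "Q0 = inQ0 (Poly_Mapping.single 1 1)"

definition Q0inv :: qtorus where
  "Q0inv = inQ0 (Poly_Mapping.single (-1) 1)"

definition Q1 :: qtorus where
  "Q1 = Q1pow 1"

lemma Q0_Q0inv: "Q0 * Q0inv = 1" "Q0inv * Q0 = 1"
  by (simp_all add: qtorus_eq_iff coeffs_mult Q0_def Q0inv_def inQ0_def qprod_single mult_single)

lemma Q1pow_mult: "Q1pow i * Q1pow j = Q1pow (i + j)"
  by (simp add: qtorus_eq_iff coeffs_mult Q1pow_def qprod_single)

lemma Q1pow_0: "Q1pow 0 = 1"
  by (simp add: qtorus_eq_iff Q1pow_def)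

lemma Q1pow_nat: "Q1pow (int n) = Q1 ^ n"
  by (induction n) (simp_all add: Q1pow_0 Q1_def Q1pow_mult[symmetric])

lemma inQ0_hom: "inQ0 0 = 0" "inQ0 1 = 1" "inQ0 (f + g) = inQ0 f + inQ0 g"
    "inQ0 (f * g) = inQ0 f * inQ0 g"
  by (simp_all add: qtorus_eq_iff coeffs_mult inQ0_def qprod_single single_add)

lemma const_hom: "const 0 = 0" "const 1 = 1" "const (u + v) = const u + const v"
    "const (u * v) = const u * const v"
  by (simp_all add: const_def single_add mult_single inQ0_hom(1-3) inQ0_hom(4)[symmetric])

lemma const_central: "const u * p = p * const u"
proof -
  have "qprod (Poly_Mapping.single 0 (Poly_Mapping.single 0 u)) F
      = qprod F (Poly_Mapping.single 0 (Poly_Mapping.single 0 u))" for F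
    by (induction F rule: poly_mapping_single_induct)
      (simp_all add: qprod_add_left qprod_add_right qprod_single dilate_single mult.commute)
  then show ?thesis by (simp add: qtorus_eq_iff coeffs_mult const_def inQ0_def)
qed

lemma Q0_Q1: "Q0 * Q1 = const (tpow 1) * Q1 * Q0"
  by (simp add: qtorus_eq_iff coeffs_mult Q0_def Q1_def Q1pow_def const_def inQ0_def
      qprod_single dilate_single mult_single)

lemma coeffs_sum: "finite A \<Longrightarrow> coeffs (\<Sum>j\<in>A. g j) = (\<Sum>j\<in>A. coeffs (g j))"
  by (induction A rule: finite_induct) simp_all

lemma coeffs_Q1pow_inQ0: "coeffs (Q1pow j * inQ0 f) = Poly_Mapping.single j f"
  by (simp add: coeffs_mult Q1pow_def inQ0_def qprod_single)

lemma qtorus_expansion: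
  "p = (\<Sum>j\<in>Poly_Mapping.keys (coeffs p). Q1pow j * inQ0 (Poly_Mapping.lookup (coeffs p) j))"
  unfolding qtorus_eq_iff
proof (rule poly_mapping_eqI)
  fix k
  show "Poly_Mapping.lookup (coeffs p) k = Poly_Mapping.lookup (coeffs
    (\<Sum>j\<in>Poly_Mapping.keys (coeffs p). Q1pow j * inQ0 (Poly_Mapping.lookup (coeffs p) j))) k"
    by (simp add: coeffs_sum coeffs_Q1pow_inQ0 lookup_sum lookup_single when_def in_keys_iff)
qed


lemma lookup_qprod_top:
  assumes "\<And>a. a \<in> Poly_Mapping.keys F \<Longrightarrow> a \<le> m" "\<And>c. c \<in> Poly_Mapping.keys G \<Longrightarrow> c \<le> n"
  shows "Poly_Mapping.lookup (qprod F G) (m + n)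
    = dilate n (Poly_Mapping.lookup F m) * Poly_Mapping.lookup G n"
proof -
  let ?s = "\<lambda>a c. Poly_Mapping.lookup (Poly_Mapping.single (a + c)
      (dilate c (Poly_Mapping.lookup F a) * Poly_Mapping.lookup G c)) (m + n)"
  have "?s a c = (if a = m then if c = n then
      dilate n (Poly_Mapping.lookup F m) * Poly_Mapping.lookup G n else 0 else 0)"
    if "a \<in> Poly_Mapping.keys F" "c \<in> Poly_Mapping.keys G" for a c
    using assms(1)[OF that(1)] assms(2)[OF that(2)] by (auto simp: lookup_single when_def)
  then have "Poly_Mapping.lookup (qprod F G) (m + n) =
    (\<Sum>a\<in>Poly_Mapping.keys F. \<Sum>c\<in>Poly_Mapping.keys G. if a = m then if c = n then
      dilate n (Poly_Mapping.lookup F m) * Poly_Mapping.lookup G n else 0 else 0)"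
    by (simp add: qprod_def lookup_sum cong: sum.cong)
  also have "\<dots> = (\<Sum>a\<in>Poly_Mapping.keys F. if a = m then
      (\<Sum>c\<in>Poly_Mapping.keys G. if c = n then
        dilate n (Poly_Mapping.lookup F m) * Poly_Mapping.lookup G n else 0) else 0)"
    by (intro sum.cong refl) auto
  also have "\<dots> = dilate n (Poly_Mapping.lookup F m) * Poly_Mapping.lookup G n"
    by (auto simp: sum.delta in_keys_iff)
  finally show ?thesis .
qed

lemma qprod_eq_0_iff: "qprod F G = 0 \<longleftrightarrow> F = 0 \<or> G = 0"
proof (rule ccontr)
  assume *: "\<not> ?thesis"
  then have ne: "F \<noteq> 0" "G \<noteq> 0" "qprod F G = 0" by auto
  define m where "m = Max (Poly_Mapping.keys F)"
  define n where "n = Max (Poly_Mapping.keys G)"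
  have "m \<in> Poly_Mapping.keys F" "n \<in> Poly_Mapping.keys G"
    unfolding m_def n_def using ne by (auto intro!: Max_in)
  moreover have "Poly_Mapping.lookup (qprod F G) (m + n)
    = dilate n (Poly_Mapping.lookup F m) * Poly_Mapping.lookup G n"
    by (rule lookup_qprod_top) (auto simp: m_def n_def)
  ultimately show False using ne(3) by (auto simp: in_keys_iff)
qed

instance qtorus :: ring_1_no_zero_divisors
  by standard (simp_all add: qtorus_eq_iff coeffs_mult qprod_eq_0_iff)

lemma inQ0_inj: "inQ0 f = inQ0 g \<longleftrightarrow> f = g"
  by (metis coeffs_Q1pow_inQ0 lookup_single_eq)

lemma const_inj: "const u = const v \<longleftrightarrow> u = v"
  by (metis const_def inQ0_inj lookup_single_eq)


section \<open>The quantum Q-system\<close>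

definition is_quantum_Qsystem :: "(int \<Rightarrow> qtorus) \<Rightarrow> bool" where
  "is_quantum_Qsystem Q \<longleftrightarrow> Q 0 = Q0 \<and> Q 1 = Q1 \<and>
     (\<forall>j. const (tpow 1) * Q (j + 1) * Q (j - 1) = Q j ^ 2 - 1)"

text \<open>
  The solution exists in the quantum torus and is unique, see \<open>quantum_Qsystem_ex1\<close>.
\<close>

definition Qhat :: "int \<Rightarrow> qtorus" where
  "Qhat = (THE Q. is_quantum_Qsystem Q)"

text \<open>
  Existence: the solution also satisfies a linear recursion
  $\widehat Q_{j+1} + t^{-1}\widehat Q_{j-1} = \widehat Q_j C$ with a conserved $C$.
  \<open>Qinv\<close> collects the properties of \<open>(x, y)\<close> = $(\widehat Q_j,\widehat Q_{j+1})$ preserved by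
  $j\mapsto j\pm1$.
\<close>

definition Qinv :: "qtorus \<Rightarrow> qtorus \<Rightarrow> qtorus \<Rightarrow> qtorus \<times> qtorus \<Rightarrow> bool" where
  "Qinv t ti C = (\<lambda>(x, y). x * y = t * (y * x) \<and>
     C * y = ti * (y * C) - ti * (ti * x) + x \<and>
     C * x = t * (x * C) + ti * y - t * y \<and>
     y * (x * C) = y * y + ti * (ti * (x * x)) - ti * ti)"

lemma Qinv_step:
  fixes t ti C x y :: qtorus
  assumes t: "\<And>p. p * t = t * p" and ti: "\<And>p. p * ti = ti * p" and inv: "t * ti = 1"
    and Q: "Qinv t ti C (x, y)"
  shows "Qinv t ti C (y, y * C - ti * x)" "Qinv t ti C (t * (x * C - y), x)"
    "t * ((y * C - ti * x) * x) = y * y - 1" "t * (y * (t * (x * C - y))) = x * x - 1"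
proof -
  have xy: "x * y = t * (y * x)" and Cy: "C * y = ti * (y * C) - ti * (ti * x) + x"
    and Cx: "C * x = t * (x * C) + ti * y - t * y"
    and E: "y * (x * C) = y * y + ti * (ti * (x * x)) - ti * ti"
    using Q by (simp_all add: Qinv_def)
  have xy': "x * (y * p) = t * (y * (x * p))" for p
    by (metis xy mult.assoc)
  have Cy': "C * (y * p) = ti * (y * (C * p)) - ti * (ti * (x * p)) + x * p" for p
    by (simp only: mult.assoc[symmetric] Cy) (simp add: algebra_simps)
  have Cx': "C * (x * p) = t * (x * (C * p)) + ti * (y * p) - t * (y * p)" for p
    by (simp only: mult.assoc[symmetric] Cx) (simp add: algebra_simps)
  have E': "y * (x * (C * p)) = y * (y * p) + ti * (ti * (x * (x * p))) - ti * (ti * p)" for p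
  proof -
    have "y * (x * (C * p)) = (y * (x * C)) * p" by (simp add: mult.assoc)
    then show ?thesis by (simp only: E) (simp add: algebra_simps)
  qed
  have inv': "ti * t = 1" using inv t by metis
  have inv2: "t * (ti * p) = p" "ti * (t * p) = p" for p
    by (simp_all add: mult.assoc[symmetric] inv inv')
  have pt: "x * t = t * x" "y * t = t * y" "C * t = t * C" "x * ti = ti * x" "y * ti = ti * y"
    "C * ti = ti * C"
    by (simp_all add: t ti)
  have pt': "x * (t * p) = t * (x * p)" "y * (t * p) = t * (y * p)" "C * (t * p) = t * (C * p)"
    "x * (ti * p) = ti * (x * p)" "y * (ti * p) = ti * (y * p)" "C * (ti * p) = ti * (C * p)" for p
    by (metis mult.assoc t ti)+
  note rules = mult.assoc distrib_left distrib_right left_diff_distrib right_diff_distrib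
    xy xy' Cy Cy' Cx Cx' E E' inv inv' inv2 pt pt'
  show "Qinv t ti C (y, y * C - ti * x)"
    by (simp add: Qinv_def rules)
  show "Qinv t ti C (t * (x * C - y), x)"
    by (simp add: Qinv_def rules)
  show "t * ((y * C - ti * x) * x) = y * y - 1"
    by (simp add: rules)
  show "t * (y * (t * (x * C - y))) = x * x - 1"
    by (simp add: rules)
qed


definition mono :: "int \<Rightarrow> int \<Rightarrow> int \<Rightarrow> qtorus" where
  "mono j b n = Qtorus (Poly_Mapping.single j (Poly_Mapping.single b (tpow n)))"

lemma mono_mult: "mono a b m * mono c d n = mono (a + c) (b + d) (m + n + c * b)"
  by (simp add: mono_def qtorus_eq_iff coeffs_mult qprod_single dilate_single mult_single
      tpow_mult algebra_simps)

lemma mono_mult': "mono a b m * (mono c d n * p) = mono (a + c) (b + d) (m + n + c * b) * p"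
  by (simp add: mono_mult flip: mult.assoc)

lemma mono_eqs: "Q0 = mono 0 1 0" "Q0inv = mono 0 (-1) 0" "Q1pow j = mono j 0 0" "Q1 = mono 1 0 0"
    "const (tpow n) = mono 0 0 n" "1 = mono 0 0 0"
  by (simp_all add: mono_def Q0_def Q0inv_def Q1pow_def Q1_def const_def inQ0_def qtorus_eq_iff)

definition Qconserved :: qtorus where
  "Qconserved = const (tpow (-1)) * (Q1 * Q0inv + Q1pow (-1) * Q0 - Q1pow (-1) * Q0inv)"

lemma Qinv_base: "Qinv (const (tpow 1)) (const (tpow (-1))) Qconserved (Q0, Q1)"
  by (simp add: Qinv_def Qconserved_def mono_eqs algebra_simps mono_mult mono_mult')

definition Qstep :: "qtorus \<times> qtorus \<Rightarrow> qtorus \<times> qtorus" where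
  "Qstep = (\<lambda>(x, y). (y, y * Qconserved - const (tpow (-1)) * x))"

definition Qback :: "qtorus \<times> qtorus \<Rightarrow> qtorus \<times> qtorus" where
  "Qback = (\<lambda>(x, y). (const (tpow 1) * (x * Qconserved - y), x))"

definition Qpair :: "int \<Rightarrow> qtorus \<times> qtorus" where
  "Qpair j = (if 0 \<le> j then (Qstep ^^ nat j) (Q0, Q1) else (Qback ^^ nat (- j)) (Q0, Q1))"

lemma const_tpow_inv [simp]: "const (tpow m) * (const (tpow n) * p) = const (tpow (m + n)) * p"
    "const (tpow m) * const (tpow n) = const (tpow (m + n))"
  by (simp_all add: const_hom(4)[symmetric] tpow_mult flip: mult.assoc)

lemma const_tpow_1_inv: "const (tpow 1) * const (tpow (- 1)) = 1"
  by (simp add: const_hom)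

lemma Qstep_Qback: "Qstep (Qback s) = s"
  by (cases s) (simp add: Qstep_def Qback_def const_hom)

lemma Qpair_step: "Qpair (j + 1) = Qstep (Qpair j)"
proof (cases "0 \<le> j")
  case True
  then have "nat (j + 1) = Suc (nat j)" by simp
  with True show ?thesis by (simp add: Qpair_def)
next
  case False
  then have "nat (- j) = Suc (nat (- (j + 1)))" by simp
  moreover have "Qpair (j + 1) = (Qback ^^ nat (- (j + 1))) (Q0, Q1)"
    using False by (cases "j = -1") (simp_all add: Qpair_def)
  ultimately show ?thesis using False by (simp add: Qpair_def Qstep_Qback)
qed

lemma Qpair_Qinv: "Qinv (const (tpow 1)) (const (tpow (-1))) Qconserved (Qpair j)"
proof -
  have *: "Qinv (const (tpow 1)) (const (tpow (-1))) Qconserved (Qstep s) \<and>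
      Qinv (const (tpow 1)) (const (tpow (-1))) Qconserved (Qback s)"
    if "Qinv (const (tpow 1)) (const (tpow (-1))) Qconserved s" for s
    using that Qinv_step(1,2)[OF const_central[symmetric] const_central[symmetric] const_tpow_1_inv]
    by (cases s) (simp add: Qstep_def Qback_def)
  have "Qinv (const (tpow 1)) (const (tpow (-1))) Qconserved ((Qstep ^^ n) (Q0, Q1))"
    "Qinv (const (tpow 1)) (const (tpow (-1))) Qconserved ((Qback ^^ n) (Q0, Q1))" for n
    by (induction n) (simp_all add: Qinv_base *)
  then show ?thesis by (simp add: Qpair_def)
qed

lemma Qpair_eq: "Qpair j = (fst (Qpair j), fst (Qpair (j + 1)))"
  by (cases "Qpair j") (simp add: Qpair_step Qstep_def)

lemma Qpair_commute: "fst (Qpair j) * fst (Qpair (j + 1))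
    = const (tpow 1) * fst (Qpair (j + 1)) * fst (Qpair j)"
  using Qpair_Qinv[of j] by (subst (asm) Qpair_eq) (simp add: Qinv_def mult.assoc)

lemma Qpair_Qsystem:
  "const (tpow 1) * fst (Qpair (j + 1)) * fst (Qpair (j - 1)) = fst (Qpair j) ^ 2 - 1"
proof -
  obtain x y where xy: "Qpair (j - 1) = (x, y)" by (cases "Qpair (j - 1)")
  have "Qpair j = Qstep (x, y)" using Qpair_step[of "j - 1"] xy by simp
  then have "fst (Qpair j) = y" "fst (Qpair (j + 1)) = y * Qconserved - const (tpow (-1)) * x"
    using Qpair_step[of j] by (simp_all add: Qstep_def)
  moreover have "const (tpow 1) * ((y * Qconserved - const (tpow (-1)) * x) * x) = y * y - 1"
    using Qinv_step(3)[OF const_central[symmetric] const_central[symmetric] const_tpow_1_inv]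
      Qpair_Qinv[of "j - 1"] xy by simp
  ultimately show ?thesis using xy by (simp add: mult.assoc power2_eq_square)
qed

lemma Qpair_is_quantum_Qsystem: "is_quantum_Qsystem (\<lambda>j. fst (Qpair j))"
  using Qpair_Qsystem Qpair_step[of 0] by (simp add: is_quantum_Qsystem_def Qpair_def Qstep_def)

lemma is_quantum_Qsystem_nonzero:
  assumes "is_quantum_Qsystem Q"
  shows "Q j \<noteq> 0"
proof
  assume 0: "Q j = 0"
  have sys: "const (tpow 1) * Q (i + 1) * Q (i - 1) = Q i ^ 2 - 1" for i
    using assms by (simp add: is_quantum_Qsystem_def)
  have "Q (j + 1) ^ 2 = 1" "Q (j - 1) ^ 2 = 1"
    using sys[of "j + 1"] sys[of "j - 1"] 0 by simp_all
  then have "Q (j + 1) = 1 \<or> Q (j + 1) = - 1" "Q (j - 1) = 1 \<or> Q (j - 1) = - 1"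
    by (simp_all add: power2_eq_square square_eq_1_iff)
  then have "const (tpow 1) = 1 \<or> const (tpow 1) = - 1"
    using sys[of j] 0 by auto
  then have "const (tpow 1) * const (tpow 1) = 1"
    by (auto simp del: const_tpow_inv)
  then have "const (tpow 2) = const (tpow 0)" by (simp add: const_hom)
  then show False by (simp add: const_inj tpow_eq_iff del: tpow_0)
qed

lemma is_quantum_Qsystem_unique:
  assumes Q: "is_quantum_Qsystem Q" and R: "is_quantum_Qsystem R"
  shows "Q = R"
proof -
  have t0: "const (tpow 1) \<noteq> 0"
    by (metis const_hom(1) const_inj tpow_neq_0)
  have sys: "const (tpow 1) * Q (i + 1) * Q (i - 1) = Q i ^ 2 - 1"
    "const (tpow 1) * R (i + 1) * R (i - 1) = R i ^ 2 - 1" for i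
    using Q R by (simp_all add: is_quantum_Qsystem_def)
  note nz = is_quantum_Qsystem_nonzero[OF R]
  have "Q i = R i \<and> Q (i + 1) = R (i + 1)" for i
  proof (induction i rule: int_induct[where k = 0])
    case base
    show ?case using Q R by (simp add: is_quantum_Qsystem_def)
  next
    case (step1 i)
    then have "const (tpow 1) * Q (i + 1 + 1) * R i = const (tpow 1) * R (i + 1 + 1) * R i"
      using sys[of "i + 1"] by simp
    then show ?case using step1 nz t0 by simp
  next
    case (step2 i)
    then have "const (tpow 1) * R (i + 1) * Q (i - 1) = const (tpow 1) * R (i + 1) * R (i - 1)"
      using sys[of i] by simp
    then show ?case using step2 nz t0 by simp
  qed
  then show ?thesis by blast
qed

theorem quantum_Qsystem_ex1: "\<exists>!Q. is_quantum_Qsystem Q"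
  using Qpair_is_quantum_Qsystem is_quantum_Qsystem_unique by blast

lemma Qhat_is_quantum_Qsystem: "is_quantum_Qsystem Qhat"
  unfolding Qhat_def using theI'[OF quantum_Qsystem_ex1] .

lemma Qhat_commute: "Qhat j * Qhat (j + 1) = const (tpow 1) * Qhat (j + 1) * Qhat j"
proof -
  have "Qhat i = fst (Qpair i)" for i
    using is_quantum_Qsystem_unique[OF Qhat_is_quantum_Qsystem Qpair_is_quantum_Qsystem]
    by (rule fun_cong)
  with Qpair_commute[of j] show ?thesis by simp
qed


section \<open>The algebra \<open>Aplus\<close> and its cyclic representation\<close>

inductive_set Aplus :: "qtorus set" where
  const: "const u \<in> Aplus"
| Q0: "Q0 \<in> Aplus"
| Q0inv: "Q0inv \<in> Aplus"
| Qhat: "1 \<le> m \<Longrightarrow> Qhat m \<in> Aplus"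
| add: "p \<in> Aplus \<Longrightarrow> q \<in> Aplus \<Longrightarrow> p + q \<in> Aplus"
| mult: "p \<in> Aplus \<Longrightarrow> q \<in> Aplus \<Longrightarrow> p * q \<in> Aplus"

text \<open>The map $\varphi$, with the polynomial $\varphi(p)$ in $\widehat Q_1$ seen in the torus.\<close>

definition phi :: "qtorus \<Rightarrow> qtorus" where
  "phi p = (\<Sum>j | j \<in> Poly_Mapping.keys (coeffs p) \<and> 0 \<le> j.
     const (eval_tpow (- j - 1) (Poly_Mapping.lookup (coeffs p) j)) * Q1 ^ nat j)"

text \<open>Only the values of \<open>act\<close> on \<open>Aplus\<close> matter.\<close>

locale right_Aplus_module = module scale
  for scale :: "zt \<Rightarrow> 'v::ab_group_add \<Rightarrow> 'v" +
  fixes act :: "'v \<Rightarrow> qtorus \<Rightarrow> 'v"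
  assumes act_add_left: "p \<in> Aplus \<Longrightarrow> act (x + y) p = act x p + act y p"
    and act_add_right: "p \<in> Aplus \<Longrightarrow> q \<in> Aplus \<Longrightarrow> act x (p + q) = act x p + act x q"
    and act_mult: "p \<in> Aplus \<Longrightarrow> q \<in> Aplus \<Longrightarrow> act x (p * q) = act (act x p) q"
    and act_one: "act x 1 = x"
    and act_scale_left: "p \<in> Aplus \<Longrightarrow> act (scale u x) p = scale u (act x p)"
    and act_scale_right: "p \<in> Aplus \<Longrightarrow> act x (const u * p) = scale u (act x p)"

text \<open>\<open>bra m\<close> is $\langle m|$.\<close>

locale cyclic_Aplus_rep = right_Aplus_module scale act
  for scale :: "zt \<Rightarrow> 'v::ab_group_add \<Rightarrow> 'v" and act :: "'v \<Rightarrow> qtorus \<Rightarrow> 'v" +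
  fixes bra :: "nat \<Rightarrow> 'v"
  assumes cyclic: "\<exists>p\<in>Aplus. x = act (bra 0) p"
    and bra_inj: "inj bra"
    and bra_independent: "independent (range bra)"
    and bra_span: "span (range bra) = UNIV"
    and bra_0_Q0: "act (bra 0) Q0 = scale (tpow (- 1)) (bra 0)"
    and bra_eq: "0 < m \<Longrightarrow> bra m = scale (tpow (int m + 1)) (act (bra 0) (Qhat (int m)))"

end

theory Submission
  imports Defs
begin

text \<open>
  The element $D = \widehat Q_1^{-1}(\widehat Q_0 - \widehat Q_0^{-1})$ belongs to $\mathcal A_+$, being
  obtained from $\widehat Q_3$, and by the linear recursion $\mathcal A_+$ is generated by
  $\widehat Q_0^{\pm1}$, $\widehat Q_1$ and $D$.  Hence $\mathcal A_+$ is a graded subring of the torus,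
  whose part of degree $-k$ is $D^k\,\mathbb Z[t^{\pm1}][\widehat Q_0^{\pm1}]$.  The part of degree $j$
  sends $\langle0|$ to vectors of $\widehat Q_0$-weight $t^{-j-1}$, which accounts for the evaluation in
  $\varphi$ when $j \ge 0$.  In negative degrees it remains to see that $\langle0|D = 0$: the spanning
  hypothesis gives $\langle0|D = \sum_m a_m\langle0|\widehat Q_m$, and since the top coefficient of
  $\widehat Q_m$ is a monomial times $\widehat Q_1^m$ while $\langle0|\widehat Q_1^m$ is not torsion,
  comparing the highest weights forces all $a_m = 0$.
\<close>

section \<open>The grading of \<open>Aplus\<close>\<close>

definition Dpoly :: lpoly where
  "Dpoly = Poly_Mapping.single 1 1 - Poly_Mapping.single (- 1) 1"

definition D :: qtorus where
  "D = Q1pow (- 1) * inQ0 Dpoly"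

text \<open>In closed form \<open>dpoly k\<close> is the product of t^{-i} x - t^i x^{-1} over i <
  k; it is the Q_0-part of D^k.\<close>

fun dpoly :: "nat \<Rightarrow> lpoly" where
  "dpoly 0 = 1"
| "dpoly (Suc k) = dilate (- 1) (dpoly k) * Dpoly"

definition component :: "qtorus \<Rightarrow> int \<Rightarrow> qtorus" where
  "component p j = Q1pow j * inQ0 (Poly_Mapping.lookup (coeffs p) j)"

lemma const_left_commute: "p * (const u * q) = const u * (p * q)"
  by (metis const_central mult.assoc)

lemma inQ0_diff: "inQ0 (f - g) = inQ0 f - inQ0 g"
  by (simp add: qtorus_eq_iff inQ0_def single_diff)

lemma inQ0_Dpoly: "inQ0 Dpoly = Q0 - Q0inv"
  by (simp add: Dpoly_def inQ0_diff Q0_def Q0inv_def)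

lemma inQ0_Q1pow: "inQ0 f * Q1pow j = Q1pow j * inQ0 (dilate j f)"
  by (simp add: qtorus_eq_iff coeffs_mult inQ0_def Q1pow_def qprod_single)

lemma inQ0_commute: "inQ0 f * inQ0 g = inQ0 g * inQ0 f"
  by (simp add: mult.commute flip: inQ0_hom(4))

lemma lookup_qprod_single_right:
  "Poly_Mapping.lookup (qprod F (Poly_Mapping.single c g)) k
    = dilate c (Poly_Mapping.lookup F (k - c)) * g"
  by (induction F rule: poly_mapping_single_induct)
    (auto simp: qprod_add_left qprod_single lookup_add dilate_add algebra_simps
      lookup_single when_def)

text \<open>A homogeneous right factor shifts degrees without mixing them, so each coefficient of
  the product comes from a single coefficient of \<open>p\<close>.\<close>

lemma lookup_coeffs_mult_single:
  "Poly_Mapping.lookup (coeffs (p * inQ0 f)) k = Poly_Mapping.lookup (coeffs p) k * f"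
  "Poly_Mapping.lookup (coeffs (p * Q1)) k = dilate 1 (Poly_Mapping.lookup (coeffs p) (k - 1))"
  "Poly_Mapping.lookup (coeffs (p * D)) k
    = dilate (- 1) (Poly_Mapping.lookup (coeffs p) (k + 1)) * Dpoly"
  by (simp_all add: coeffs_mult[of p] coeffs_Q1pow_inQ0 lookup_qprod_single_right D_def)
    (simp_all add: lookup_qprod_single_right inQ0_def Q1_def Q1pow_def)

lemma D_power: "D ^ k = Q1pow (- int k) * inQ0 (dpoly k)"
proof (induction k)
  case (Suc k)
  have "D ^ Suc k = Q1pow (- int k) * (inQ0 (dpoly k) * Q1pow (- 1)) * inQ0 Dpoly"
    using Suc by (simp add: power_Suc2 D_def mult.assoc flip: power_Suc)
  also have "\<dots> = (Q1pow (- int k) * Q1pow (- 1)) * (inQ0 (dilate (- 1) (dpoly k)) * inQ0 Dpoly)"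
    by (simp only: inQ0_Q1pow mult.assoc)
  finally show ?case
    by (simp add: Q1pow_mult inQ0_hom add.commute)
qed (simp add: Q1pow_0 inQ0_hom)

lemma Q1_D: "Q1 * D = Q0 - Q0inv"
  by (simp add: D_def Q1_def Q1pow_mult Q1pow_0 inQ0_Dpoly flip: mult.assoc)

lemma Qhat_recursion: "Qhat (j + 1) = Qhat j * Qconserved - const (tpow (- 1)) * Qhat (j - 1)"
proof -
  have eq: "Qhat i = fst (Qpair i)" for i
    using is_quantum_Qsystem_unique[OF Qhat_is_quantum_Qsystem Qpair_is_quantum_Qsystem]
    by (rule fun_cong)
  show ?thesis
    using Qpair_eq[of "j - 1"] Qpair_step[of "j - 1"] Qpair_step[of j]
    by (simp add: eq Qstep_def split_beta)
qed

lemma Qhat_0_1: "Qhat 0 = Q0" "Qhat 1 = Q1"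
  using Qhat_is_quantum_Qsystem by (simp_all add: is_quantum_Qsystem_def)

lemma Qconserved_eq: "Qconserved = const (tpow (- 1)) * (Q1 * Q0inv + D)"
  by (simp add: Qconserved_def D_def inQ0_Dpoly algebra_simps)

section \<open>Elements of \<open>Aplus\<close>: Laurent polynomials in Q_0, and D\<close>

lemma Aplus_0: "0 \<in> Aplus" and Aplus_1: "1 \<in> Aplus"
  using Aplus.const[of 0] Aplus.const[of 1] by (simp_all add: const_hom)

lemma const_uminus: "const (- u) = - const u"
  by (metis const_hom(1,3) add.right_inverse minus_unique)

lemma Aplus_diff: "p \<in> Aplus \<Longrightarrow> q \<in> Aplus \<Longrightarrow> p - q \<in> Aplus"
  using Aplus.add[OF _ Aplus.mult[OF Aplus.const[of "- 1"]], of p q]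
  by (simp add: const_uminus const_hom)

lemma Aplus_power: "p \<in> Aplus \<Longrightarrow> p ^ n \<in> Aplus"
  by (induction n) (auto intro: Aplus_1 Aplus.mult)

lemma Aplus_sum: "(\<And>i. i \<in> I \<Longrightarrow> f i \<in> Aplus) \<Longrightarrow> sum f I \<in> Aplus"
  by (induction I rule: infinite_finite_induct) (auto intro: Aplus_0 Aplus.add)

lemma Q1_in_Aplus: "Q1 \<in> Aplus"
  using Aplus.Qhat[of 1] by (simp add: Qhat_0_1)

lemma inQ0_single: "inQ0 (Poly_Mapping.single b u)
    = const u * (if 0 \<le> b then Q0 ^ nat b else Q0inv ^ nat (- b))"
proof -
  have pow: "Q0 ^ n = inQ0 (Poly_Mapping.single (int n) 1)"
    "Q0inv ^ n = inQ0 (Poly_Mapping.single (- int n) 1)" for n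
    by (induction n) (simp_all add: inQ0_hom(2) Q0_def Q0inv_def mult_single flip: inQ0_hom(4))
  show ?thesis
    by (simp add: pow const_def mult_single flip: inQ0_hom(4))
qed

lemma inQ0_in_Aplus: "inQ0 f \<in> Aplus"
proof (induction f rule: poly_mapping_single_induct)
  case (single b u)
  show ?case
    unfolding inQ0_single by (intro Aplus.intros(6) Aplus.const) (simp add: Aplus_power Aplus.intros)
qed (simp_all add: inQ0_hom Aplus_0 Aplus.add)

lemma D_in_Aplus: "D \<in> Aplus"
proof -
  have Q2: "Qhat 2 = Q1 * Qconserved - const (tpow (- 1)) * Q0"
    and Q3: "Qhat 3 = Qhat 2 * Qconserved - const (tpow (- 1)) * Q1"
    using Qhat_recursion[of 1] Qhat_recursion[of 2] by (simp_all add: Qhat_0_1)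
  \<comment> \<open>In t Q_3 = Q_2 Q_1 Q_0^{-1} + Q_2 D - Q_1 one has Q_2 D = Q_1 (Q_0 - Q_0^{-1})
    Q_0^{-1} - D Q_0^{-1}. Solving for D and using D Q_0^{-1} = t^{-1} Q_0^{-1} D produces the left
    factor t^2 Q_0.\<close>
  have "D = const (tpow 2) * Q0 * (const (tpow (- 1)) * Qhat 2 * Q1 * Q0inv
      + const (tpow (- 1)) * Q1 * (Q0 - Q0inv) * Q0inv - const (tpow (- 1)) * Q1 - Qhat 3)"
    by (simp add: Q3 Q2 Qconserved_eq D_def inQ0_Dpoly mono_eqs algebra_simps mono_mult mono_mult')
  also have "\<dots> \<in> Aplus"
    by (intro Aplus_diff Aplus.mult Aplus.const Aplus.add Aplus.Q0 Aplus.Q0inv Q1_in_Aplus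
        Aplus.Qhat) simp_all
  finally show ?thesis .
qed

text \<open>
  Membership of the components in \<open>Aplus\<close>, phrased as a condition on coefficients that is visibly
  stable under right multiplication by the generators.
\<close>

definition divisible_coeffs :: "qtorus \<Rightarrow> bool" where
  "divisible_coeffs p \<longleftrightarrow> (\<forall>k. dpoly k dvd Poly_Mapping.lookup (coeffs p) (- int k))"

lemma dilate_dvd: "f dvd g \<Longrightarrow> dilate c f dvd dilate c g"
  by (auto simp: dvd_def dilate_mult)

lemma divisible_coeffs_add: "divisible_coeffs p \<Longrightarrow> divisible_coeffs q \<Longrightarrow> divisible_coeffs (p + q)"
  by (simp add: divisible_coeffs_def lookup_add)

lemma divisible_coeffs_diff: "divisible_coeffs p \<Longrightarrow> divisible_coeffs q \<Longrightarrow> divisible_coeffs (p - q)"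
  by (simp add: divisible_coeffs_def lookup_minus)

lemma divisible_coeffs_mult_inQ0: "divisible_coeffs p \<Longrightarrow> divisible_coeffs (p * inQ0 f)"
  by (simp add: divisible_coeffs_def lookup_coeffs_mult_single)

text \<open>Degree -k of the product comes from degree -k-1 of \<open>p\<close>, and dilating
  \<open>dpoly (Suc k)\<close> by 1 gives \<open>dpoly k\<close> times a further factor.\<close>

lemma divisible_coeffs_mult_Q1:
  assumes "divisible_coeffs p"
  shows "divisible_coeffs (p * Q1)"
  unfolding divisible_coeffs_def lookup_coeffs_mult_single
proof
  fix k
  have "dilate 1 (dpoly (Suc k)) dvd dilate 1 (Poly_Mapping.lookup (coeffs p) (- int (Suc k)))"
    using assms by (intro dilate_dvd) (simp only: divisible_coeffs_def)
  moreover have "dpoly k dvd dilate 1 (dpoly (Suc k))"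
    by (simp add: dilate_mult dilate_dilate)
  moreover have "- int (Suc k) = - int k - 1" by simp
  ultimately show "dpoly k dvd dilate 1 (Poly_Mapping.lookup (coeffs p) (- int k - 1))"
    by (metis dvd_trans)
qed

text \<open>Degree -l-1 comes from degree -l, and the dilation and the factor \<open>Dpoly\<close>
  are exactly those in the recursion of \<open>dpoly\<close>.\<close>

lemma divisible_coeffs_mult_D:
  assumes "divisible_coeffs p"
  shows "divisible_coeffs (p * D)"
  unfolding divisible_coeffs_def lookup_coeffs_mult_single
proof
  fix k
  show "dpoly k dvd dilate (- 1) (Poly_Mapping.lookup (coeffs p) (- int k + 1)) * Dpoly"
  proof (cases k)
    case (Suc l)
    have "dpoly l dvd Poly_Mapping.lookup (coeffs p) (- int l)"
      using assms by (simp add: divisible_coeffs_def)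
    moreover have "- int k + 1 = - int l" using Suc by simp
    ultimately show ?thesis
      using Suc by (simp add: mult_dvd_mono dilate_dvd)
  qed simp
qed

lemma divisible_coeffs_1: "divisible_coeffs 1"
proof -
  have "dpoly k dvd Poly_Mapping.lookup 1 (- int k)" for k
    by (cases k) (simp_all add: lookup_one when_def)
  then show ?thesis by (simp add: divisible_coeffs_def)
qed

text \<open>Two consecutive indices are carried along because the linear recursion has order
  two.\<close>

lemma divisible_coeffs_mult_Qhat:
  "divisible_coeffs p \<Longrightarrow> divisible_coeffs (p * Qhat (int m)) \<and> divisible_coeffs (p * Qhat (int m + 1))"
proof (induction m arbitrary: p)
  case 0
  then show ?case
    by (simp add: Qhat_0_1 divisible_coeffs_mult_Q1) (simp add: Q0_def divisible_coeffs_mult_inQ0)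
next
  case (Suc m)
  have mult_const: "divisible_coeffs (const u * q)" if "divisible_coeffs q" for u q
    using divisible_coeffs_mult_inQ0[OF that, of "Poly_Mapping.single 0 u"]
    by (simp add: const_central) (simp add: const_def)
  have "divisible_coeffs (q * Qconserved)" if "divisible_coeffs q" for q
    using that unfolding Qconserved_eq
    by (simp add: const_central Q0inv_def distrib_left divisible_coeffs_add divisible_coeffs_mult_Q1
        divisible_coeffs_mult_D divisible_coeffs_mult_inQ0 mult_const flip: mult.assoc const_central)
  moreover have "p * Qhat (int m + 2) = (p * Qhat (int m + 1)) * Qconserved
      - const (tpow (- 1)) * (p * Qhat (int m))"
    using Qhat_recursion[of "int m + 1"]
    by (simp add: right_diff_distrib mult.assoc add.commute const_left_commute[of p])
  ultimately have "divisible_coeffs (p * Qhat (int m + 2))"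
    using Suc by (simp add: divisible_coeffs_diff mult_const)
  with Suc show ?case by (simp add: add.commute)
qed

lemma divisible_coeffs_Aplus:
  assumes "p \<in> Aplus"
  shows "divisible_coeffs p"
proof -
  \<comment> \<open>With an arbitrary left factor \<open>q\<close> the product case of the induction
    is just associativity; q = 1 gives the claim.\<close>
  have "divisible_coeffs (q * p)" if "divisible_coeffs q" for q
    using assms that
  proof (induction arbitrary: q)
    case (Qhat m)
    then show ?case using divisible_coeffs_mult_Qhat[of q "nat m"] by simp
  qed (simp_all add: const_def Q0_def Q0inv_def divisible_coeffs_mult_inQ0
      divisible_coeffs_add distrib_left flip: mult.assoc)
  then show ?thesis using divisible_coeffs_1 by fastforce
qed

section \<open>Homogeneous components of elements of \<open>Aplus\<close>\<close>

lemma component_nonneg: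
  "0 \<le> j \<Longrightarrow> component p j = Q1 ^ nat j * inQ0 (Poly_Mapping.lookup (coeffs p) j)"
  using Q1pow_nat[of "nat j"] by (simp add: component_def)

lemma component_neg:
  assumes "p \<in> Aplus" "j < 0"
  obtains f where "component p j = D ^ nat (- j) * inQ0 f"
proof -
  have "dpoly (nat (- j)) dvd Poly_Mapping.lookup (coeffs p) j"
    using divisible_coeffs_Aplus[OF assms(1)] assms(2)
    unfolding divisible_coeffs_def by (metis int_nat_eq minus_minus neg_0_le_iff_le order_less_imp_le)
  then obtain f where "Poly_Mapping.lookup (coeffs p) j = dpoly (nat (- j)) * f" by (rule dvdE)
  with assms(2) have "component p j = D ^ nat (- j) * inQ0 f"
    by (simp add: component_def D_power inQ0_hom mult.assoc)
  then show thesis by (rule that)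
qed

text \<open>The module laws for \<open>act\<close> hold on \<open>Aplus\<close> only; this lets them
  be applied to each component separately.\<close>

lemma component_in_Aplus: "p \<in> Aplus \<Longrightarrow> component p j \<in> Aplus"
proof (cases "0 \<le> j")
  case True
  then show ?thesis
    by (simp add: component_nonneg Aplus.mult Aplus_power Q1_in_Aplus inQ0_in_Aplus)
next
  case False
  assume "p \<in> Aplus"
  then obtain f where "component p j = D ^ nat (- j) * inQ0 f"
    using component_neg False by (meson not_le)
  then show ?thesis by (simp add: Aplus.mult Aplus_power D_in_Aplus inQ0_in_Aplus)
qed

lemma sum_component: "(\<Sum>j\<in>Poly_Mapping.keys (coeffs p). component p j) = p"
  unfolding component_def by (rule qtorus_expansion[symmetric])

lemma component_Q0: "component p j * Q0 = const (tpow (- j)) * (Q0 * component p j)"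
proof -
  have "Q0 * Q1pow j = Q1pow j * (const (tpow j) * Q0)"
    by (simp add: mono_eqs mono_mult mono_mult')
  then have "Q0 * component p j = const (tpow j) * (component p j * Q0)"
    by (simp add: component_def Q0_def inQ0_commute mult.assoc)
      (metis mult.assoc const_central)
  then show ?thesis by (simp add: const_hom)
qed

section \<open>Leading coefficients of the Q-system\<close>

lemma lookup_coeffs_const_mult:
  "Poly_Mapping.lookup (coeffs (const u * p)) j
    = Poly_Mapping.lookup (coeffs p) j * Poly_Mapping.single 0 u"
  by (simp add: const_central) (simp add: const_def lookup_coeffs_mult_single)

lemma lookup_coeffs_Qhat_recursion:
  "Poly_Mapping.lookup (coeffs (Qhat (m + 1))) j =
    (dilate 1 (Poly_Mapping.lookup (coeffs (Qhat m)) (j - 1)) * Poly_Mapping.single (- 1) 1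
      + dilate (- 1) (Poly_Mapping.lookup (coeffs (Qhat m)) (j + 1)) * Dpoly
      - Poly_Mapping.lookup (coeffs (Qhat (m - 1))) j) * Poly_Mapping.single 0 (tpow (- 1))"
proof -
  have "Qhat (m + 1)
      = const (tpow (- 1)) * (Qhat m * Q1 * inQ0 (Poly_Mapping.single (- 1) 1) + Qhat m * D - Qhat (m - 1))"
    by (simp add: Qhat_recursion[of m] Qconserved_eq Q0inv_def const_left_commute
        right_diff_distrib distrib_left mult.assoc)
  then show ?thesis
    by (simp add: lookup_coeffs_const_mult lookup_coeffs_mult_single lookup_add lookup_minus
        del: coeffs_simps) (simp add: lookup_coeffs_mult_single lookup_add lookup_minus)
qed

text \<open>A monomial is required, not just a nonzero polynomial, because evaluation at a power of
  t cannot annihilate it.\<close>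

definition monomial_top :: "int \<Rightarrow> qtorus \<Rightarrow> bool" where
  "monomial_top m p \<longleftrightarrow> (\<forall>j>m. Poly_Mapping.lookup (coeffs p) j = 0) \<and>
    (\<exists>b n. Poly_Mapping.lookup (coeffs p) m = Poly_Mapping.single b (tpow n))"

lemma monomial_top_Qhat: "monomial_top (int m) (Qhat (int m))"
proof -
  have "monomial_top (int m) (Qhat (int m)) \<and> monomial_top (int m + 1) (Qhat (int m + 1))"
  proof (induction m)
    case 0
    have "\<exists>b n. Poly_Mapping.single 1 1 = Poly_Mapping.single b (tpow n)"
      "\<exists>b n. 1 = Poly_Mapping.single b (tpow n)"
      by (metis tpow_0, metis tpow_0 single_one)
    then show ?case
      by (simp add: monomial_top_def Qhat_0_1 Q0_def inQ0_def Q1_def Q1pow_def lookup_single when_def)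
  next
    case (Suc m)
    then obtain b n where
      "Poly_Mapping.lookup (coeffs (Qhat (int m + 1))) (int m + 1) = Poly_Mapping.single b (tpow n)"
      by (auto simp: monomial_top_def)
    \<comment> \<open>Only the summand ending in Q_1 Q_0^{-1} reaches degree m + 2: the dilation
      contributes t^b, the factor Q_0^{-1} lowers b by one, and the outer t^{-1} gives the last
      -1.\<close>
    with Suc have "Poly_Mapping.lookup (coeffs (Qhat (int m + 2))) (int m + 2)
        = Poly_Mapping.single (b - 1) (tpow (b + n - 1))"
      using lookup_coeffs_Qhat_recursion[of "int m + 1" "int m + 2"]
      by (simp add: monomial_top_def dilate_single mult_single tpow_mult add.commute)
    moreover have "\<forall>j>int m + 2. Poly_Mapping.lookup (coeffs (Qhat (int m + 2))) j = 0"
      using Suc lookup_coeffs_Qhat_recursion[of "int m + 1"]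
      by (simp add: monomial_top_def add.commute)
    ultimately have "monomial_top (int m + 2) (Qhat (int m + 2))"
      by (auto simp: monomial_top_def)
    with Suc show ?case by (simp add: add.commute)
  qed
  then show ?thesis ..
qed

section \<open>Evaluation at powers of t\<close>

lemma eval_tpow_single: "eval_tpow k (Poly_Mapping.single b u) = u * tpow (k * b)"
  by (cases "u = 0") (simp_all add: eval_tpow_def)

lemma eval_tpow_add: "eval_tpow k (f + g) = eval_tpow k f + eval_tpow k g"
  unfolding eval_tpow_def
  by (rule sum_keys_add[where g = "\<lambda>b u. u * tpow (k * b)"]) (simp_all add: distrib_right)

lemma eval_tpow_0: "eval_tpow k 0 = 0"
  by (simp add: eval_tpow_def)

section \<open>Weight vectors\<close>

context right_Aplus_module
begin

lemma act_0_left: "p \<in> Aplus \<Longrightarrow> act 0 p = 0"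
  using act_add_left[of p 0 0] by simp

lemma act_0_right: "act x 0 = 0"
  using act_add_right[of 0 0 x] Aplus_0 by simp

lemma act_diff_right: "p \<in> Aplus \<Longrightarrow> q \<in> Aplus \<Longrightarrow> act x (p - q) = act x p - act x q"
  using act_add_right[of "p - q" q x] by (simp add: Aplus_diff)

lemma act_sum_left: "p \<in> Aplus \<Longrightarrow> act (sum f I) p = (\<Sum>i\<in>I. act (f i) p)"
  by (induction I rule: infinite_finite_induct) (auto simp: act_0_left act_add_left)

lemma act_sum_right: "(\<And>i. i \<in> I \<Longrightarrow> f i \<in> Aplus) \<Longrightarrow> act x (sum f I) = (\<Sum>i\<in>I. act x (f i))"
  by (induction I rule: infinite_finite_induct) (auto simp: act_0_right act_add_right Aplus_sum)

lemma act_Q0inv: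
  assumes "act x Q0 = scale (tpow w) x"
  shows "act x Q0inv = scale (tpow (- w)) x"
proof -
  have "x = act (act x Q0) Q0inv"
    by (simp add: Q0_Q0inv act_one Aplus.intros flip: act_mult)
  also have "\<dots> = scale (tpow w) (act x Q0inv)"
    by (simp add: assms act_scale_left Aplus.intros)
  finally have "scale (tpow (- w)) x = scale (tpow (- w) * tpow w) (act x Q0inv)"
    by (metis scale_scale)
  then show ?thesis by (simp add: tpow_mult)
qed

text \<open>This is the origin of the evaluation in \<open>phi\<close>: on a vector of weight w, Q_0
  may be replaced by t^w.\<close>

lemma act_inQ0:
  assumes "act x Q0 = scale (tpow w) x"
  shows "act x (inQ0 f) = scale (eval_tpow w f) x"
proof -
  have pow: "act x (q ^ n) = scale (tpow (c * int n)) x"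
    if "act x q = scale (tpow c) x" "q \<in> Aplus" for q c n
    by (induction n)
      (simp_all add: act_one act_mult Aplus_power act_scale_left that tpow_mult algebra_simps)
  show ?thesis
  proof (induction f rule: poly_mapping_single_induct)
    case (single b u)
    show ?case
      unfolding inQ0_single
      using pow[OF assms Aplus.Q0, of "nat b"] pow[OF act_Q0inv[OF assms] Aplus.Q0inv, of "nat (- b)"]
      by (simp add: act_scale_right Aplus_power Aplus.intros eval_tpow_single)
  next
    case (add f g)
    then show ?case
      by (simp add: inQ0_hom eval_tpow_add act_add_right inQ0_in_Aplus scale_left_distrib)
  qed (simp add: inQ0_hom eval_tpow_0 act_0_right)
qed

lemma weight_vectors_independent:
  assumes torsion_free: "\<And>a x. scale a x = 0 \<Longrightarrow> a = 0 \<or> x = 0"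
    and "finite J" "inj_on w J" "\<And>j. j \<in> J \<Longrightarrow> act (x j) Q0 = scale (tpow (w j)) (x j)"
    and "(\<Sum>j\<in>J. x j) = 0" "j \<in> J"
  shows "x j = 0"
  using assms(2-)
proof (induction J arbitrary: x j rule: finite_induct)
  case (insert i J)
  \<comment> \<open>Applying Q_0 to the relation and subtracting t^{w i} times it eliminates
    \<open>x i\<close>; the rescaled vectors keep their weights, so the induction hypothesis
    applies.\<close>
  have "(\<Sum>j\<in>J. scale (tpow (w j) - tpow (w i)) (x j))
      = act (\<Sum>j\<in>insert i J. x j) Q0 - scale (tpow (w i)) (\<Sum>j\<in>insert i J. x j)"
    using insert.hyps insert.prems(2) by (simp add: act_sum_left Aplus.Q0 scale_left_diff_distrib
        sum_subtractf scale_sum_right act_add_left scale_right_distrib)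
  also have "\<dots> = 0"
    using insert.prems(3) by (simp only: act_0_left Aplus.Q0) simp
  finally have "scale (tpow (w j) - tpow (w i)) (x j) = 0" if "j \<in> J" for j
    using insert.prems(1,2) that
    by (intro insert.IH[of "\<lambda>j. scale (tpow (w j) - tpow (w i)) (x j)" j])
      (auto simp: act_scale_left Aplus.Q0 mult.commute)
  moreover have "tpow (w j) \<noteq> tpow (w i)" if "j \<in> J" for j
    using insert.hyps insert.prems(1) that by (metis inj_on_eq_iff insertCI tpow_eq_iff)
  ultimately have zero: "x j = 0" if "j \<in> J" for j
    using torsion_free that by (metis eq_iff_diff_eq_0)
  then have "x i = 0" using insert.prems(3) insert.hyps by simp
  with zero insert.prems(4) show ?case by auto
qed simp

end

section \<open>The cyclic vector and its weight components\<close>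

context cyclic_Aplus_rep
begin

lemma torsion_free:
  assumes "scale a x = 0"
  shows "a = 0 \<or> x = 0"
proof (rule ccontr)
  assume *: "\<not> ?thesis"
  obtain S c where S: "finite S" "S \<subseteq> range bra" "x = (\<Sum>s\<in>S. scale (c s) s)"
    using bra_span unfolding span_explicit by blast
  have "(\<Sum>s\<in>S. scale (a * c s) s) = 0"
    using assms S(3) by (simp add: scale_sum_right)
  then have "a * c s = 0" if "s \<in> S" for s
    using independentD[OF bra_independent S(1,2), of "\<lambda>s. a * c s"] that by blast
  with * S(3) show False by simp
qed

lemma bra_0_nonzero: "bra 0 \<noteq> 0"
  using bra_independent dependent_zero by (metis rangeI)

text \<open>Moving Q_0 to the left of a degree j element costs t^{-j}, and the cyclic vector
  supplies another t^{-1}.\<close>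

lemma act_component:
  assumes "p \<in> Aplus"
  shows "act (act (bra 0) (component p j)) Q0
    = scale (tpow (- j - 1)) (act (bra 0) (component p j))"
proof -
  have "act (act (bra 0) (component p j)) Q0 = act (bra 0) (component p j * Q0)"
    by (simp add: act_mult component_in_Aplus assms Aplus.Q0)
  also have "\<dots> = scale (tpow (- j)) (act (act (bra 0) Q0) (component p j))"
    by (simp add: component_Q0 act_scale_right act_mult Aplus.Q0 Aplus.mult component_in_Aplus assms)
  also have "\<dots> = scale (tpow (- j) * tpow (- 1)) (act (bra 0) (component p j))"
    by (simp add: bra_0_Q0 act_scale_left component_in_Aplus assms)
  finally show ?thesis by (simp add: tpow_mult)
qed

lemma act_eq_sum_component:
  assumes "p \<in> Aplus"
  shows "act (bra 0) p = (\<Sum>j\<in>Poly_Mapping.keys (coeffs p). act (bra 0) (component p j))"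
  using act_sum_right[of "Poly_Mapping.keys (coeffs p)" "component p" "bra 0"]
  by (simp add: component_in_Aplus assms sum_component)

text \<open>Components of different degree have different weights, hence cannot cancel each
  other.\<close>

lemma act_component_eq_0:
  assumes "p \<in> Aplus" "act (bra 0) p = 0"
  shows "act (bra 0) (component p j) = 0"
proof (cases "j \<in> Poly_Mapping.keys (coeffs p)")
  case True
  have "inj_on (\<lambda>j. - j - 1 :: int) (Poly_Mapping.keys (coeffs p))"
    by (simp add: inj_on_def)
  moreover have "(\<Sum>j\<in>Poly_Mapping.keys (coeffs p). act (bra 0) (component p j)) = 0"
    using act_eq_sum_component[OF assms(1)] assms(2) by simp
  ultimately show ?thesis
    using weight_vectors_independent[where J = "Poly_Mapping.keys (coeffs p)" and j = j and w = "\<lambda>j. - j - 1"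
        and x = "\<lambda>j. act (bra 0) (component p j)"] torsion_free act_component[OF assms(1)] True
    by simp
qed (simp add: component_def in_keys_iff inQ0_hom act_0_right)

lemma act_Q1_power_Q0: "act (act (bra 0) (Q1 ^ n)) Q0 = scale (tpow (- int n - 1)) (act (bra 0) (Q1 ^ n))"
proof -
  have "component (Q1 ^ n) (int n) = Q1 ^ n"
    by (simp add: component_def Q1pow_def inQ0_hom flip: Q1pow_nat)
  then show ?thesis
    using act_component[of "Q1 ^ n" "int n"] by (simp add: Aplus_power Q1_in_Aplus)
qed

lemma act_component_nonneg:
  assumes "0 \<le> j"
  shows "act (bra 0) (component p j)
    = scale (eval_tpow (- j - 1) (Poly_Mapping.lookup (coeffs p) j)) (act (bra 0) (Q1 ^ nat j))"
  using act_inQ0[OF act_Q1_power_Q0[of "nat j"]] assms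
  by (simp add: component_nonneg act_mult Aplus_power Q1_in_Aplus inQ0_in_Aplus)

text \<open>Since Q_1 D = Q_0 - Q_0^{-1}, applying D to <0|Q_1^{n+1} returns (t^{-n-1} - t^{n+1})
  <0|Q_1^n, which is nonzero by induction and torsion-freeness.\<close>

lemma act_Q1_power_nonzero: "act (bra 0) (Q1 ^ n) \<noteq> 0"
proof (induction n)
  case 0
  then show ?case by (simp add: act_one bra_0_nonzero)
next
  case (Suc n)
  let ?y = "act (bra 0) (Q1 ^ n)"
  have "act (act (bra 0) (Q1 ^ Suc n)) D = act (bra 0) (Q1 ^ n * (Q1 * D))"
    by (simp add: Aplus_power Q1_in_Aplus D_in_Aplus Aplus.mult power_Suc2 mult.assoc
        del: power_Suc flip: act_mult)
  also have "\<dots> = act ?y Q0 - act ?y Q0inv"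
    by (simp add: Q1_D act_mult act_diff_right Aplus_diff Aplus.intros Aplus_power Q1_in_Aplus)
  also have "\<dots> = scale (tpow (- int n - 1) - tpow (int n + 1)) ?y"
    using act_Q0inv[OF act_Q1_power_Q0[of n]]
    by (simp add: act_Q1_power_Q0 scale_left_diff_distrib add.commute)
  finally have "act (act (bra 0) (Q1 ^ Suc n)) D = scale (tpow (- int n - 1) - tpow (int n + 1)) ?y" .
  moreover have "tpow (- int n - 1) - tpow (int n + 1) \<noteq> 0"
    by (simp add: tpow_eq_iff)
  ultimately show ?case
    using Suc torsion_free act_0_left[OF D_in_Aplus] by metis
qed

text \<open>The case \<open>m = 0\<close> holds because $\langle0|\widehat Q_0 = t^{-1}\langle0|$.\<close>

lemma bra_conv_Qhat: "bra m = scale (tpow (int m + 1)) (act (bra 0) (Qhat (int m)))"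
  by (cases "m = 0") (simp_all add: Qhat_0_1 bra_0_Q0 tpow_mult bra_eq)

text \<open>Looking only at the weight of <0|D would not suffice, as \<open>Qhat 3\<close> already
  has a component of degree -1. The argument therefore takes the largest index with a nonzero
  coefficient.\<close>

lemma act_D: "act (bra 0) D = 0"
proof -
  obtain S c where S: "finite S" "S \<subseteq> range bra" "act (bra 0) D = (\<Sum>s\<in>S. scale (c s) s)"
    using bra_span unfolding span_explicit by blast
  obtain M where M: "finite M" "S = bra ` M"
    using S(1,2) by (meson finite_subset_image)
  have Qhat_in: "Qhat (int m) \<in> Aplus" for m
    by (cases "m = 0") (auto simp: Qhat_0_1 intro: Aplus.intros)
  define a where "a m = c (bra m) * tpow (int m + 1)" for m
  \<comment> \<open>The expansion of <0|D becomes the statement that the single element P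
    annihilates <0|, so all its components do too.\<close>
  define P where "P = (\<Sum>m\<in>M. const (a m) * Qhat (int m)) - D"
  have eq: "act (bra 0) D = (\<Sum>m\<in>M. scale (a m) (act (bra 0) (Qhat (int m))))"
  proof -
    have "act (bra 0) D = (\<Sum>m\<in>M. scale (c (bra m)) (bra m))"
      using S(3) M(2) bra_inj by (simp add: sum.reindex inj_on_subset)
    also have "\<dots> = (\<Sum>m\<in>M. scale (a m) (act (bra 0) (Qhat (int m))))"
      by (intro sum.cong refl, subst (2) bra_conv_Qhat) (simp add: a_def)
    finally show ?thesis .
  qed
  have sum_in: "(\<Sum>m\<in>M. const (a m) * Qhat (int m)) \<in> Aplus"
    by (intro Aplus_sum Aplus.mult Aplus.const Qhat_in)
  then have P: "P \<in> Aplus" by (simp add: P_def Aplus_diff D_in_Aplus)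
  have "act (bra 0) P = 0"
    using sum_in by (simp add: P_def act_diff_right D_in_Aplus act_sum_right act_scale_right
        Aplus.mult Aplus.const Qhat_in eq)
  have "a m = 0" if "m \<in> M" for m
  proof (rule ccontr)
    assume "a m \<noteq> 0"
    define N where "N = Max {m \<in> M. a m \<noteq> 0}"
    have "N \<in> {m \<in> M. a m \<noteq> 0}"
      unfolding N_def using \<open>a m \<noteq> 0\<close> that M(1) by (intro Max_in) auto
    then have N: "N \<in> M" "a N \<noteq> 0" by auto
    have max: "a k = 0" if "k \<in> M" "N < k" for k
      using that M(1) Max_ge[of "{m \<in> M. a m \<noteq> 0}" k] by (auto simp flip: N_def)
    obtain b n where top:
      "Poly_Mapping.lookup (coeffs (Qhat (int N))) (int N) = Poly_Mapping.single b (tpow n)"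
      using monomial_top_Qhat[of N] by (auto simp: monomial_top_def)
    \<comment> \<open>D lives in degree -1 and drops out. Indices below N do not reach degree N, and
      those above have coefficient 0.\<close>
    have "Poly_Mapping.lookup (coeffs P) (int N)
        = (\<Sum>m\<in>M. Poly_Mapping.lookup (coeffs (Qhat (int m))) (int N) * Poly_Mapping.single 0 (a m))"
      using M(1) by (simp add: P_def lookup_minus coeffs_sum lookup_sum lookup_coeffs_const_mult
          D_def coeffs_Q1pow_inQ0 lookup_single when_def)
    also have "\<dots> = (\<Sum>m\<in>M. if m = N then Poly_Mapping.single b (tpow n) * Poly_Mapping.single 0 (a N) else 0)"
    proof (intro sum.cong refl)
      fix k assume "k \<in> M"
      then show "Poly_Mapping.lookup (coeffs (Qhat (int k))) (int N) * Poly_Mapping.single 0 (a k)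
          = (if k = N then Poly_Mapping.single b (tpow n) * Poly_Mapping.single 0 (a N) else 0)"
        using max[of k] top monomial_top_Qhat[of k]
        by (cases k N rule: linorder_cases) (auto simp: monomial_top_def)
    qed
    also have "\<dots> = Poly_Mapping.single b (tpow n * a N)"
      using M(1) N(1) by (simp add: mult_single)
    finally have "eval_tpow (- int N - 1) (Poly_Mapping.lookup (coeffs P) (int N)) \<noteq> 0"
      using N(2) by (simp add: eval_tpow_single)
    moreover have "scale (eval_tpow (- int N - 1) (Poly_Mapping.lookup (coeffs P) (int N)))
        (act (bra 0) (Q1 ^ N)) = 0"
      using act_component_eq_0[OF P \<open>act (bra 0) P = 0\<close>, of "int N"] act_component_nonneg[of "int N" P]
      by simp
    ultimately show False
      using torsion_free act_Q1_power_nonzero by blast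
  qed
  then show ?thesis using eq by simp
qed

text \<open>The action is from the right, so the leftmost factor D meets <0| first and kills
  it.\<close>

lemma act_component_neg:
  assumes "p \<in> Aplus" "j < 0"
  shows "act (bra 0) (component p j) = 0"
proof -
  obtain f where "component p j = D ^ nat (- j) * inQ0 f"
    using component_neg[OF assms] .
  moreover have "nat (- j) = Suc (nat (- j - 1))" using assms(2) by simp
  ultimately have "component p j = D * (D ^ nat (- j - 1) * inQ0 f)"
    by (simp only: power_Suc mult.assoc)
  then show ?thesis
    by (simp add: act_mult act_D act_0_left D_in_Aplus Aplus.mult Aplus_power inQ0_in_Aplus)
qed

lemma act_phi:
  "act (bra 0) (phi p) = (\<Sum>j | j \<in> Poly_Mapping.keys (coeffs p) \<and> 0 \<le> j. act (bra 0) (component p j))"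
  unfolding phi_def
  by (subst act_sum_right)
    (auto simp: act_scale_right act_component_nonneg Aplus_power Q1_in_Aplus
      intro!: Aplus.mult Aplus.const)

end

theorem lemma4p22:
  fixes scale :: "zt \<Rightarrow> 'v::ab_group_add \<Rightarrow> 'v"
    and act :: "'v \<Rightarrow> qtorus \<Rightarrow> 'v"
    and bra :: "nat \<Rightarrow> 'v"
    and p :: qtorus
  assumes "cyclic_Aplus_rep scale act bra"
    and "p \<in> Aplus"
  shows "act (bra 0) p = act (bra 0) (phi p)"
proof -
  interpret cyclic_Aplus_rep scale act bra by fact
  show ?thesis
    unfolding act_phi act_eq_sum_component[OF assms(2)]
    \<comment> \<open>The terms missing from the sum for \<open>phi p\<close> are those of negative
      degree, which vanish.\<close>
    by (rule sum.mono_neutral_right) (auto, metis act_component_neg[OF assms(2)] not_le)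
qed

end
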